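(* Let $n\neq 0,-1$ be an integer and $M=E_{T(2,2n+1)}\cup N(Kb)$ the graph manifold obtained by $4$-surgery along the $n$-twist knot $K_n$. For every irreducible representation $\bar\rho:\pi_1(M)\to SL(2,\mathbb{C})$, the restriction of $\bar\rho$ to $\pi_1(N(Kb))$ is irreducible.
   Context: The $n$-twist knot $K_n$ is the two-bridge knot whose group has the presentation $\pi_1(E_{K_n})=\langle \alpha,\beta\mid \omega^n\alpha=\beta\omega^n\rangle$ with $\alpha,\beta$ meridians and $\omega=\beta\alpha^{-1}\beta^{-1}\alpha$; its Alexander polynomial is $-nt^2+(2n+1)t-n$, and $K_1$ is the figure-eight knot. $N(Kb)$ is the twisted $I$-bundle over the Klein bottle, $E_{T(2,2n+1)}$ the exterior of the $(2,2n+1)$ torus knot. $M$ is the union of these along a torus, with $\pi_1(M)=\langle a,b,x,y\mid a^2=b^{2n+1},\ x^{-1}yx=y^{-1},\ \mu=y^{-1},\ h=y^{-1}x^2\rangle$, where $\pi_1(N(Kb))=\langle x,y\mid x^{-1}yx=y^{-1}\rangle$, $\mu=b^{-n}a$ is a meridian and $h$ a regular fiber of $E_{T(2,2n+1)}$. A representation is irreducible if the only subspaces of $\mathbb{C}^2$ invariant under its image are $\{0\}$ and $\mathbb{C}^2$. *)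

theory Defs
  imports "HOL-Analysis.Analysis"
begin

type_synonym cmat = "complex^2^2"

text \<open>Natural and integer powers of 2x2 complex matrices.\<close>
primrec mat_npow :: "cmat \<Rightarrow> nat \<Rightarrow> cmat" where
  "mat_npow A 0 = mat 1"
| "mat_npow A (Suc k) = A ** mat_npow A k"

definition mat_ipow :: "cmat \<Rightarrow> int \<Rightarrow> cmat" where
  "mat_ipow A k = (if 0 \<le> k then mat_npow A (nat k) else mat_npow (matrix_inv A) (nat (- k)))"

definition SL2C :: "cmat set" where
  "SL2C = {A. det A = 1}"

text \<open>The matrix group generated by a set of invertible matrices
  (the image of a representation of a group generated by given elements).\<close>
inductive_set gen_group :: "cmat set \<Rightarrow> cmat set" for S :: "cmat set" where
  gen_one: "mat 1 \<in> gen_group S"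
| gen_mult: "g \<in> gen_group S \<Longrightarrow> s \<in> S \<Longrightarrow> g ** s \<in> gen_group S"
| gen_inv: "g \<in> gen_group S \<Longrightarrow> s \<in> S \<Longrightarrow> g ** matrix_inv s \<in> gen_group S"

text \<open>A set of matrices G (the image of a representation) acts irreducibly on C^2:
  the only complex subspaces invariant under all of G are {0} and C^2.\<close>
definition irreducible_image :: "cmat set \<Rightarrow> bool" where
  "irreducible_image G \<longleftrightarrow>
     (\<forall>W :: (complex^2) set.
        module.subspace ((*s) :: complex \<Rightarrow> complex^2 \<Rightarrow> complex^2) W \<and>
        (\<forall>g\<in>G. \<forall>w\<in>W. g *v w \<in> W)
        \<longrightarrow> W = {0} \<or> W = UNIV)"

text \<open>Representations of pi_1(M) = < a,b,x,y | a^2 = b^(2n+1), x^-1 y x = y^-1,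
  mu = y^-1, h = y^-1 x^2 >, with mu = b^-n a and h = a^2 the regular fiber,
  into SL(2,C), given by the images A,B,X,Y of the generators.\<close>
definition is_rep_M :: "int \<Rightarrow> cmat \<Rightarrow> cmat \<Rightarrow> cmat \<Rightarrow> cmat \<Rightarrow> bool" where
  "is_rep_M n A B X Y \<longleftrightarrow>
     A \<in> SL2C \<and> B \<in> SL2C \<and> X \<in> SL2C \<and> Y \<in> SL2C \<and>
     A ** A = mat_ipow B (2 * n + 1) \<and>
     matrix_inv X ** Y ** X = matrix_inv Y \<and>
     mat_ipow B (- n) ** A = matrix_inv Y \<and>
     A ** A = matrix_inv Y ** X ** X"

end

theory Submission
  imports Defs
begin

text \<open>A subgroup of \<open>SL(2,\<complex>)\<close> acts reducibly on \<open>\<complex>\<^sup>2\<close> exactly when its generators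
  have a common eigenvector, so it suffices to show that every eigenvector \<open>v\<close> of \<open>Y\<close> is
  an eigenvector of \<open>A\<close> and \<open>B\<close>. If \<open>Y\<close> is scalar, the relations force \<open>B = I\<close> and
  \<open>A = Y\<close>. Otherwise the eigenlines of the non-scalar \<open>Y\<close> are preserved by everything
  commuting with \<open>Y\<close>, in particular by \<open>A\<^sup>2 = Y\<^sup>-\<^sup>1X\<^sup>2\<close>, because \<open>X\<close> conjugates \<open>Y\<close>
  to \<open>Y\<^sup>-\<^sup>1\<close>. If \<open>A\<^sup>2\<close> is not scalar, the same argument applied to \<open>A\<close> and to \<open>B\<close>,
  which commute with \<open>A\<^sup>2 = B\<^sup>2\<^sup>n\<^sup>+\<^sup>1\<close>, finishes the proof. If \<open>A\<^sup>2 = cI\<close>, then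
  \<open>X\<^sup>2 = cY\<close>, so \<open>X\<close> commutes with \<open>Y\<close>, whence \<open>Y = Y\<^sup>-\<^sup>1\<close>; but an involution of
  determinant one is \<open>\<plusminus>I\<close>, contradicting that \<open>Y\<close> is not scalar.\<close>

lemma matrix_inv_right:
  fixes A :: "'a::field^'n^'n"
  assumes "invertible A"
  shows "A ** matrix_inv A = mat 1"
  using someI_ex[OF assms[unfolded invertible_def]] unfolding matrix_inv_def by blast

lemma matrix_inv_left:
  fixes A :: "'a::field^'n^'n"
  assumes "invertible A"
  shows "matrix_inv A ** A = mat 1"
  using matrix_inv_right[OF assms] matrix_left_right_inverse by blast

lemma matrix_inv_unique:
  fixes A B :: "'a::field^'n^'n"
  assumes "A ** B = mat 1"
  shows "matrix_inv A = B"
proof -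
  have "invertible A"
    using assms invertible_right_inverse by blast
  then have "matrix_inv A = (matrix_inv A ** A) ** B"
    using assms by (simp add: matrix_mul_assoc[symmetric])
  then show ?thesis
    using matrix_inv_left[OF \<open>invertible A\<close>] by simp
qed

lemma invertible_mult_left_cancel:
  fixes M A B :: "'a::field^'n^'n"
  assumes "invertible M" "M ** A = M ** B"
  shows "A = B"
  using arg_cong[OF assms(2), of "(**) (matrix_inv M)"]
  by (simp add: matrix_mul_assoc matrix_inv_left[OF assms(1)])

lemma invertible_mult_right_cancel:
  fixes M A B :: "'a::field^'n^'n"
  assumes "invertible M" "A ** M = B ** M"
  shows "A = B"
  using arg_cong[OF assms(2), of "\<lambda>C. C ** matrix_inv M"]
  by (simp add: matrix_mul_assoc[symmetric] matrix_inv_right[OF assms(1)])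

lemma SL2C_invertible: "A \<in> SL2C \<Longrightarrow> invertible A"
  by (simp add: SL2C_def invertible_det_nz)

lemma mat_mult_vec: "(mat c :: 'a::semiring_1^'n^'n) *v x = c *s x"
  by (simp add: vec_eq_iff matrix_vector_mult_def mat_def if_distrib if_distribR cong: if_cong)

lemma mat_mult_commute: "(M :: 'a::field^'n^'n) ** mat c = mat c ** M"
  by (simp add: matrix_eq matrix_vector_mul_assoc[symmetric] mat_mult_vec vector_scalar_commute)

lemma mat_mult_mat: "(mat a :: 'a::field^'n^'n) ** mat b = mat (a * b)"
  by (simp add: matrix_eq matrix_vector_mul_assoc[symmetric] mat_mult_vec)

lemma mat_npow_commute: "mat_npow M k ** M = M ** mat_npow M k"
  by (induction k) (simp_all add: matrix_mul_assoc[symmetric])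

lemma mat_ipow_0 [simp]: "mat_ipow M 0 = mat 1"
  by (simp add: mat_ipow_def)

lemma mat_ipow_1 [simp]: "mat_ipow M 1 = M"
  by (simp add: mat_ipow_def)

lemma mat_ipow_mat_1 [simp]: "mat_ipow (mat 1) k = mat 1"
proof -
  have "mat_npow (mat 1) m = mat 1" for m
    by (induction m) simp_all
  moreover have "matrix_inv (mat 1 :: cmat) = mat 1"
    by (rule matrix_inv_unique) simp
  ultimately show ?thesis
    by (simp add: mat_ipow_def)
qed

lemma mat_ipow_succ:
  assumes "invertible M"
  shows "mat_ipow M (k + 1) = mat_ipow M k ** M"
proof (cases "0 \<le> k")
  case True
  then have "nat (k + 1) = Suc (nat k)"
    by simp
  with True show ?thesis
    by (simp add: mat_ipow_def mat_npow_commute)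
next
  case False
  define m where "m = nat (- (k + 1))"
  then have "nat (- k) = Suc m"
    using False by simp
  have "matrix_inv M ** (mat_npow (matrix_inv M) m ** M)
      = mat_npow (matrix_inv M) m ** (matrix_inv M ** M)"
    by (simp add: matrix_mul_assoc mat_npow_commute)
  then show ?thesis
    using False \<open>nat (- k) = Suc m\<close> m_def matrix_inv_left[OF assms]
    by (auto simp: mat_ipow_def matrix_mul_assoc)
qed

lemma mat_ipow_add:
  assumes "invertible M"
  shows "mat_ipow M (i + j) = mat_ipow M i ** mat_ipow M j"
proof (induction j rule: int_induct[where k = 0])
  case base
  then show ?case by simp
next
  case (step1 j)
  then show ?case
    using mat_ipow_succ[OF assms, of "i + j"] mat_ipow_succ[OF assms, of j]
    by (simp add: add.assoc matrix_mul_assoc)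
next
  case (step2 j)
  have "mat_ipow M (i + j) = mat_ipow M (i + (j - 1)) ** M"
       "mat_ipow M j = mat_ipow M (j - 1) ** M"
    using mat_ipow_succ[OF assms, of "i + (j - 1)"] mat_ipow_succ[OF assms, of "j - 1"] by simp_all
  then have "mat_ipow M (i + (j - 1)) ** M = (mat_ipow M i ** mat_ipow M (j - 1)) ** M"
    using step2 by (simp add: matrix_mul_assoc)
  then show ?case
    by (rule invertible_mult_right_cancel[OF assms])
qed

lemma mat_ipow_commute:
  assumes "invertible M"
  shows "M ** mat_ipow M k = mat_ipow M k ** M"
  using mat_ipow_add[OF assms, of 1 k] mat_ipow_add[OF assms, of k 1] by (simp add: add.commute)

lemma vec2_multiple_or_spanning:
  fixes v w :: "'a::field^2"
  assumes "v \<noteq> 0"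
  shows "(\<exists>c. w = c *s v) \<or> (\<forall>z. \<exists>a b. z = a *s v + b *s w)"
proof (cases "v$1 * w$2 = v$2 * w$1")
  case True
  show ?thesis
  proof (cases "v$1 = 0")
    case v1: True
    then have "v$2 \<noteq> 0"
      using assms by (simp add: vec_eq_iff forall_2)
    with True v1 have "w = (w$2 / v$2) *s v"
      by (simp add: vec_eq_iff forall_2)
    then show ?thesis by blast
  next
    case False
    with True have "w = (w$1 / v$1) *s v"
      by (simp add: vec_eq_iff forall_2 field_simps)
    then show ?thesis by blast
  qed
next
  case False
  define d where "d = v$1 * w$2 - v$2 * w$1"
  have "d \<noteq> 0"
    using False by (simp add: d_def)
  have "z = ((z$1 * w$2 - z$2 * w$1) / d) *s v + ((v$1 * z$2 - v$2 * z$1) / d) *s w" for z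
  proof -
    have "(z$1 * w$2 - z$2 * w$1) * v$1 + (v$1 * z$2 - v$2 * z$1) * w$1 = z$1 * d"
         "(z$1 * w$2 - z$2 * w$1) * v$2 + (v$1 * z$2 - v$2 * z$1) * w$2 = z$2 * d"
      by (simp_all add: d_def algebra_simps)
    then show ?thesis
      using \<open>d \<noteq> 0\<close> by (simp add: vec_eq_iff forall_2 add_divide_distrib[symmetric])
  qed
  then show ?thesis by blast
qed

lemma exists_vec2_not_multiple: "\<exists>w :: 'a::field^2. \<forall>c. w \<noteq> c *s v"
proof (rule ccontr)
  assume "\<not> ?thesis"
  then obtain c d where "axis 1 1 = c *s v" "axis 2 1 = d *s v"
    by blast
  then have "c * v$1 = 1" "c * v$2 = 0" "d * v$1 = 0" "d * v$2 = 1"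
    by (simp_all add: vec_eq_iff forall_2 axis_def)
  then show False
    by (cases "v$1 = 0") auto
qed

lemma kernel_line:
  fixes N :: "'a::field^2^2"
  assumes "N \<noteq> 0" "v \<noteq> 0" "N *v v = 0" "N *v w = 0"
  shows "\<exists>c. w = c *s v"
proof (rule ccontr)
  assume "\<not> ?thesis"
  then have spanning: "\<forall>z. \<exists>a b. z = a *s v + b *s w"
    using vec2_multiple_or_spanning[OF assms(2)] by blast
  have "N *v z = 0" for z
  proof -
    obtain a b where "z = a *s v + b *s w"
      using spanning by blast
    then show ?thesis
      using assms(3,4) by (simp add: matrix_vector_right_distrib vector_scalar_commute)
  qed
  then have "N = 0"
    by (simp add: matrix_eq)
  with assms(1) show False ..
qed

lemma eigenvector_of_commuting_nonscalar:
  fixes M N :: "'a::field^2^2"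
  assumes "M ** N = N ** M" "\<nexists>s. N = mat s" "v \<noteq> 0" "N *v v = l *s v"
  shows "\<exists>c. M *v v = c *s v"
proof -
  define K where "K = N - mat l"
  have "K \<noteq> 0"
    using assms(2) by (auto simp: K_def)
  have K_kernel: "K *v x = 0 \<longleftrightarrow> N *v x = l *s x" for x
    by (simp add: K_def matrix_vector_mult_diff_rdistrib mat_mult_vec)
  have "N *v (M *v v) = M *v (N *v v)"
    using assms(1) by (simp add: matrix_vector_mul_assoc)
  also have "\<dots> = l *s (M *v v)"
    using assms(4) by (simp add: vector_scalar_commute)
  finally have "N *v (M *v v) = l *s (M *v v)" .
  with assms(3,4) K_kernel show ?thesis
    using kernel_line[OF \<open>K \<noteq> 0\<close>] by blast
qed

lemma SL2_involution_scalar: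
  fixes Y :: "'a::field_char_0^2^2"
  assumes "det Y = 1" "Y ** Y = mat 1"
  shows "\<exists>s. Y = mat s"
proof -
  obtain a b c d where Y: "Y$1$1 = a" "Y$1$2 = b" "Y$2$1 = c" "Y$2$2 = d"
    by blast
  have "a * d - b * c = 1"
    using assms(1) Y by (simp add: det_2)
  moreover have "a * a + b * c = 1" "b * (a + d) = 0" "c * (a + d) = 0" "d * d + b * c = 1"
    using assms(2) Y by (simp_all add: vec_eq_iff forall_2 matrix_matrix_mult_def mat_def
        sum_2 algebra_simps)
  \<comment> \<open>Cayley--Hamilton: \<open>tr(Y) Y = Y\<^sup>2 + det(Y) I = 2 I\<close>.\<close>
  ultimately have "a * (a + d) = 2" "d * (a + d) = 2" "b * (a + d) = 0" "c * (a + d) = 0"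
    by (simp_all add: algebra_simps)
  then have "a + d \<noteq> 0" "b = 0" "c = 0" "(a - d) * (a + d) = 0"
    by (auto simp: left_diff_distrib)
  then have "b = 0" "c = 0" "a = d"
    by auto
  then have "Y = mat a"
    using Y by (simp add: vec_eq_iff forall_2 mat_def)
  then show ?thesis ..
qed

lemma gen_group_subset: "S \<subseteq> gen_group S"
  using gen_group.gen_mult[OF gen_group.gen_one] by fastforce

lemma gen_group_common_eigenvector:
  assumes "g \<in> gen_group S" "v \<noteq> 0"
    and "\<forall>s\<in>S. invertible s" "\<forall>s\<in>S. \<exists>c. s *v v = c *s v"
  shows "\<exists>c. g *v v = c *s v"
  using assms(1)
proof induction
  case gen_one
  have "mat 1 *v v = 1 *s v"
    by simp
  then show ?case ..
next
  case (gen_mult g s)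
  then obtain c d where "g *v v = c *s v" "s *v v = d *s v"
    using assms(4) by blast
  then have "(g ** s) *v v = (d * c) *s v"
    by (metis matrix_vector_mul_assoc vector_scalar_commute vector_smult_assoc)
  then show ?case ..
next
  case (gen_inv g s)
  then obtain c d where c: "g *v v = c *s v" and d: "s *v v = d *s v"
    using assms(4) by blast
  have "v = matrix_inv s *v (s *v v)"
    using matrix_inv_left[of s] assms(3) gen_inv(2) by (simp add: matrix_vector_mul_assoc)
  also have "\<dots> = d *s (matrix_inv s *v v)"
    using d by (simp add: vector_scalar_commute)
  finally have v: "v = d *s (matrix_inv s *v v)" .
  with assms(2) have "d \<noteq> 0"
    by auto
  with v have "matrix_inv s *v v = (1 / d) *s v"
    by (simp add: vec_eq_iff)
  with c have "(g ** matrix_inv s) *v v = (c / d) *s v"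
    by (simp add: matrix_vector_mul_assoc[symmetric] vector_scalar_commute)
  then show ?case ..
qed

lemma irreducible_gen_group_iff:
  assumes "\<forall>s\<in>S. invertible s"
  shows "irreducible_image (gen_group S) \<longleftrightarrow>
    \<not> (\<exists>v. v \<noteq> 0 \<and> (\<forall>s\<in>S. \<exists>c. s *v v = c *s v))"
proof
  assume irreducible: "irreducible_image (gen_group S)"
  show "\<not> (\<exists>v. v \<noteq> 0 \<and> (\<forall>s\<in>S. \<exists>c. s *v v = c *s v))"
  proof
    assume "\<exists>v. v \<noteq> 0 \<and> (\<forall>s\<in>S. \<exists>c. s *v v = c *s v)"
    then obtain v where v: "v \<noteq> 0" "\<forall>s\<in>S. \<exists>c. s *v v = c *s v"
      by blast
    define W where "W = vec.span {v}"
    have "\<forall>g\<in>gen_group S. \<forall>w\<in>W. g *v w \<in> W"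
    proof (intro ballI)
      fix g w
      assume "g \<in> gen_group S" "w \<in> W"
      then obtain c d where "g *v v = c *s v" "w = d *s v"
        using gen_group_common_eigenvector[OF _ v(1) assms v(2)]
        unfolding W_def vec.span_singleton by blast
      then have "g *v w = (d * c) *s v"
        by (simp add: vector_scalar_commute)
      then show "g *v w \<in> W"
        unfolding W_def vec.span_singleton by blast
    qed
    moreover have "W \<noteq> {0}"
      using v(1) vec.span_base[of v "{v}"] by (auto simp: W_def)
    moreover have "W \<noteq> UNIV"
      using exists_vec2_not_multiple[of v] by (auto simp: W_def vec.span_singleton)
    ultimately show False
      using irreducible vec.subspace_span[of "{v}"] unfolding irreducible_image_def W_def by blast
  qed
next
  assume no_common_eigenvector: "\<not> (\<exists>v. v \<noteq> 0 \<and> (\<forall>s\<in>S. \<exists>c. s *v v = c *s v))"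
  show "irreducible_image (gen_group S)"
  proof (rule ccontr)
    assume "\<not> irreducible_image (gen_group S)"
    then obtain W where W: "vec.subspace W" "\<forall>g\<in>gen_group S. \<forall>w\<in>W. g *v w \<in> W"
      "W \<noteq> {0}" "W \<noteq> UNIV"
      unfolding irreducible_image_def by blast
    then obtain v where v: "v \<in> W" "v \<noteq> 0"
      using vec.subspace_0 by blast
    have line: "\<exists>c. w = c *s v" if "w \<in> W" for w
    proof (rule ccontr)
      assume "\<nexists>c. w = c *s v"
      then have "z \<in> W" for z
        using vec2_multiple_or_spanning[OF v(2), of w] v(1) that W(1)
        by (metis vec.subspace_add vec.subspace_scale)
      with W(4) show False
        by blast
    qed
    have "\<forall>s\<in>S. \<exists>c. s *v v = c *s v"
      using line W(2) v(1) gen_group_subset by blast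
    with v(2) no_common_eigenvector show False
      by blast
  qed
qed

context
  fixes X Y :: "'a::field^'n^'n"
  assumes X: "invertible X" and Y: "invertible Y"
    and conj: "matrix_inv X ** Y ** X = matrix_inv Y"
begin

lemma conj_inverse_commute_left: "Y ** X = X ** matrix_inv Y"
proof -
  have "Y ** X = X ** (matrix_inv X ** Y ** X)"
    by (simp add: matrix_mul_assoc matrix_inv_right[OF X])
  then show ?thesis
    by (simp only: conj)
qed

lemma conj_inverse_commute_right: "matrix_inv Y ** X = X ** Y"
proof -
  have "X ** Y = matrix_inv Y ** (Y ** X) ** Y"
    by (simp add: matrix_mul_assoc matrix_inv_left[OF Y])
  also have "\<dots> = matrix_inv Y ** (X ** matrix_inv Y) ** Y"
    by (simp only: conj_inverse_commute_left)
  also have "\<dots> = matrix_inv Y ** X"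
    by (simp add: matrix_mul_assoc[symmetric] matrix_inv_left[OF Y])
  finally show ?thesis
    by (rule sym)
qed

lemma conj_inverse_commute_square: "Y ** (X ** X) = (X ** X) ** Y"
proof -
  have "Y ** (X ** X) = X ** (matrix_inv Y ** X)"
    by (simp only: matrix_mul_assoc conj_inverse_commute_left)
  also have "\<dots> = (X ** X) ** Y"
    by (simp only: matrix_mul_assoc conj_inverse_commute_right)
  finally show ?thesis .
qed

lemma conj_inverse_commuting_involution:
  assumes "X ** Y = Y ** X"
  shows "Y ** Y = mat 1"
proof -
  have "X ** Y = X ** matrix_inv Y"
    unfolding assms by (rule conj_inverse_commute_left)
  then have "Y = matrix_inv Y"
    by (rule invertible_mult_left_cancel[OF X])
  then show ?thesis
    using matrix_inv_right[OF Y] by simp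
qed

end

context
  fixes n :: int and A B X Y :: cmat
  assumes rep: "is_rep_M n A B X Y"
begin

lemma rep_M_invertible: "invertible A" "invertible B" "invertible X" "invertible Y"
  using rep by (simp_all add: is_rep_M_def SL2C_invertible)

lemma rep_M_det_Y: "det Y = 1"
  using rep by (simp add: is_rep_M_def SL2C_def)

lemma rep_M_relations:
  "A ** A = mat_ipow B (2 * n + 1)"
  "matrix_inv X ** Y ** X = matrix_inv Y"
  "mat_ipow B (- n) ** A = matrix_inv Y"
  "A ** A = matrix_inv Y ** (X ** X)"
  using rep unfolding is_rep_M_def matrix_mul_assoc by blast+

lemma rep_M_A_sq_commute_B: "B ** (A ** A) = (A ** A) ** B"
  unfolding rep_M_relations(1) by (rule mat_ipow_commute[OF rep_M_invertible(2)])

lemma rep_M_A_sq_commute_Y: "Y ** (A ** A) = (A ** A) ** Y"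
proof -
  have XX: "Y ** (X ** X) = (X ** X) ** Y"
    by (rule conj_inverse_commute_square[OF rep_M_invertible(3,4) rep_M_relations(2)])
  have "(A ** A) ** Y = matrix_inv Y ** ((X ** X) ** Y)"
    by (simp add: rep_M_relations(4) matrix_mul_assoc)
  also have "\<dots> = matrix_inv Y ** (Y ** (X ** X))"
    by (simp add: XX)
  also have "\<dots> = X ** X"
    by (simp add: matrix_mul_assoc matrix_inv_left[OF rep_M_invertible(4)])
  also have "\<dots> = Y ** (A ** A)"
    by (simp add: rep_M_relations(4) matrix_mul_assoc matrix_inv_right[OF rep_M_invertible(4)])
  finally show ?thesis
    by (rule sym)
qed

lemma rep_M_scalar_Y:
  assumes "Y = mat s"
  shows "A = mat s \<and> B = mat 1"
proof -
  define P where "P = mat_ipow B n"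
  have P_inverse: "P ** mat_ipow B (- n) = mat 1"
    using mat_ipow_add[OF rep_M_invertible(2), of n "- n"] by (simp add: P_def)
  have "s * s = 1"
    using rep_M_det_Y assms by (simp add: det_2 mat_def)
  then have Y_inverse: "matrix_inv Y = mat s"
    using assms by (intro matrix_inv_unique) (simp add: mat_mult_mat)
  have A: "A = P ** mat s"
  proof -
    have "A = P ** (mat_ipow B (- n) ** A)"
      by (simp add: matrix_mul_assoc P_inverse)
    also have "\<dots> = P ** mat s"
      by (simp only: rep_M_relations(3) Y_inverse)
    finally show ?thesis .
  qed
  have "(P ** P) ** B = mat_ipow B (2 * n + 1)"
    unfolding P_def mult_2 mat_ipow_add[OF rep_M_invertible(2)] mat_ipow_1 ..
  also have "\<dots> = P ** (mat s ** P) ** mat s"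
    by (simp add: rep_M_relations(1)[symmetric] A matrix_mul_assoc)
  also have "\<dots> = P ** (P ** mat s) ** mat s"
    by (simp only: mat_mult_commute[of P s])
  also have "\<dots> = (P ** P) ** mat (s * s)"
    by (simp only: matrix_mul_assoc[symmetric] mat_mult_mat)
  also have "\<dots> = (P ** P) ** mat 1"
    by (simp only: \<open>s * s = 1\<close>)
  finally have "(P ** P) ** B = (P ** P) ** mat 1" .
  moreover have "invertible P"
    unfolding invertible_right_inverse using P_inverse by blast
  ultimately have "B = mat 1"
    using invertible_mult_left_cancel[OF invertible_mult] by blast
  with A show ?thesis
    by (simp add: P_def)
qed

lemma rep_M_scalar_A_sq:
  assumes "A ** A = mat c"
  shows "Y ** Y = mat 1"
proof -
  have "invertible (mat c :: cmat)"
    using invertible_mult[OF rep_M_invertible(1,1)] assms by simp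
  have "mat c = matrix_inv Y ** (X ** X)"
    using rep_M_relations(4) unfolding assms .
  then have X_sq: "X ** X = Y ** mat c"
    by (simp add: matrix_mul_assoc matrix_inv_right[OF rep_M_invertible(4)])
  have "(X ** Y) ** mat c = X ** (X ** X)"
    by (simp add: matrix_mul_assoc[symmetric] X_sq)
  also have "\<dots> = (X ** X) ** X"
    by (simp only: matrix_mul_assoc)
  also have "\<dots> = Y ** (mat c ** X)"
    by (simp only: X_sq matrix_mul_assoc)
  also have "\<dots> = (Y ** X) ** mat c"
    by (simp only: mat_mult_commute matrix_mul_assoc)
  finally have "X ** Y = Y ** X"
    by (rule invertible_mult_right_cancel[OF \<open>invertible (mat c :: cmat)\<close>])
  then show ?thesis
    by (rule conj_inverse_commuting_involution[OF rep_M_invertible(3,4) rep_M_relations(2)])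
qed

lemma rep_M_eigenvector_of_Y:
  assumes "v \<noteq> 0" "Y *v v = l *s v"
  shows "(\<exists>a. A *v v = a *s v) \<and> (\<exists>b. B *v v = b *s v)"
proof (cases "\<exists>s. Y = mat s")
  case True
  then obtain s where "A = mat s" "B = mat 1"
    using rep_M_scalar_Y by blast
  then have "A *v v = s *s v" "B *v v = 1 *s v"
    by (simp_all add: mat_mult_vec)
  then show ?thesis
    by blast
next
  case Y_nonscalar: False
  obtain c where A_sq: "(A ** A) *v v = c *s v"
    using eigenvector_of_commuting_nonscalar[OF rep_M_A_sq_commute_Y[symmetric] Y_nonscalar assms]
    by blast
  have A_sq_nonscalar: "\<nexists>s. A ** A = mat s"
  proof
    assume "\<exists>s. A ** A = mat s"
    then have "Y ** Y = mat 1"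
      using rep_M_scalar_A_sq by blast
    then show False
      using SL2_involution_scalar[OF rep_M_det_Y] Y_nonscalar by blast
  qed
  have "A ** (A ** A) = (A ** A) ** A"
    by (simp add: matrix_mul_assoc)
  then have "\<exists>a. A *v v = a *s v"
    by (rule eigenvector_of_commuting_nonscalar[OF _ A_sq_nonscalar assms(1) A_sq])
  moreover have "\<exists>b. B *v v = b *s v"
    by (rule eigenvector_of_commuting_nonscalar[OF rep_M_A_sq_commute_B A_sq_nonscalar assms(1) A_sq])
  ultimately show ?thesis ..
qed

end

theorem proposition3p8:
  fixes n :: int and A B X Y :: "complex^2^2"
  assumes "n \<noteq> 0" and "n \<noteq> -1"
    and "is_rep_M n A B X Y"
    and "irreducible_image (gen_group {A, B, X, Y})"
  shows "irreducible_image (gen_group {X, Y})"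
proof -
  have invertible: "\<forall>s\<in>{A, B, X, Y}. invertible s" "\<forall>s\<in>{X, Y}. invertible s"
    using rep_M_invertible[OF assms(3)] by auto
  have "\<nexists>v. v \<noteq> 0 \<and> (\<forall>s\<in>{X, Y}. \<exists>c. s *v v = c *s v)"
  proof
    assume "\<exists>v. v \<noteq> 0 \<and> (\<forall>s\<in>{X, Y}. \<exists>c. s *v v = c *s v)"
    then obtain v m l where v: "v \<noteq> 0" "X *v v = m *s v" "Y *v v = l *s v"
      by auto
    then obtain a b where "A *v v = a *s v" "B *v v = b *s v"
      using rep_M_eigenvector_of_Y[OF assms(3)] by blast
    with v have "\<exists>v. v \<noteq> 0 \<and> (\<forall>s\<in>{A, B, X, Y}. \<exists>c. s *v v = c *s v)"
      by blast
    with assms(4) show False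
      using irreducible_gen_group_iff[OF invertible(1)] by blast
  qed
  then show ?thesis
    using irreducible_gen_group_iff[OF invertible(2)] by blast
qed

end
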